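(* Let $\mathcal{H}=\mathcal{H}_M\oplus\mathcal{H}_K$ be a Hilbert space decomposed into an (orthogonal) direct sum of closed subspaces with orthogonal projections $P_M,P_K$ onto $\mathcal{H}_M,\mathcal{H}_K$ respectively, let $\Phi=\{\varphi_i\}_{i\in I}$ be a Parseval frame for $\mathcal{H}$, and let $\Lambda\subseteq I$. Fix $\delta>0$ and suppose that $x^0\in\mathcal{H}$ is $\delta$-clustered sparse in $\Phi$ with respect to $\Lambda$, i.e. $\|\mathbb{1}_{\Lambda^c}\Phi^\ast x^0\|_1\le\delta$. Let $x^\star$ solve $$x^\star=\operatorname{argmin}_x\|\Phi^\ast x\|_1\quad\text{subject to}\quad P_Kx=P_Kx^0 .$$ Then $$\|x^\star-x^0\|_2\le\frac{2\delta}{1-2\mu_c(\Lambda,P_M\Phi;\Phi)} .$$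
   Context: A family $\{\varphi_i\}_{i\in I}$ in a separable Hilbert space $\mathcal{H}$ is a Parseval frame if $\sum_{i\in I}|\langle x,\varphi_i\rangle|^2=\|x\|^2$ for all $x\in\mathcal{H}$. $\Phi^\ast x=(\langle x,\varphi_i\rangle)_{i\in I}$ is the analysis operator; $\mathbb{1}_{A}$ restricts a sequence indexed by $I$ to $A\subseteq I$ (zero elsewhere) and $\Lambda^c=I\setminus\Lambda$. $\|\cdot\|_1$ is the $\ell_1$ norm of a sequence, and $\|\cdot\|_2$ on $\mathcal{H}$ denotes the Hilbert space norm. $P_M\Phi=\{P_M\varphi_i\}_{i\in I}$. For families $\Phi_1=\{\varphi_{1i}\}_{i\in I}$, $\Phi_2=\{\varphi_{2j}\}_{j\in J}$ in $\mathcal{H}$ and $\Lambda\subseteq I$, the cluster coherence is $\mu_c(\Lambda,\Phi_1;\Phi_2)=\max_{j\in J}\sum_{i\in\Lambda}|\langle\varphi_{1i},\varphi_{2j}\rangle|$.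
   Formalization: The bound is proved under the extra hypothesis μ_c(Λ,P_MΦ;Φ)<1/2 (otherwise it is negative or undefined), and the minimisation runs over feasible x with finite ‖Φ*x‖_1, so x* has finite ℓ1 norm; the maximum in μ_c is read as a supremum. *)

theory Defs
  imports "HOL-Analysis.Analysis"
begin

text \<open>
  The only models of the following class are the reals and the complex numbers:
  each scalar \<open>x\<close> is a root of the real quadratic
  \<open>(X - x) * (X - sconj x)\<close>. It lets one statement cover real and complex Hilbert spaces.
\<close>

class real_or_complex = real_normed_field +
  fixes sconj :: "'a \<Rightarrow> 'a"
  assumes sconj_add: "sconj (x + y) = sconj x + sconj y"
    and sconj_mult: "sconj (x * y) = sconj x * sconj y"
    and mult_sconj: "x * sconj x = (norm x)\<^sup>2 *\<^sub>R 1"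
    and add_sconj: "\<exists>r. x + sconj x = r *\<^sub>R 1"

instantiation real :: real_or_complex
begin

definition sconj_real :: "real \<Rightarrow> real" where
  "sconj_real x = x"

instance
  by standard (auto simp: sconj_real_def power2_eq_square)

end

instantiation complex :: real_or_complex
begin

definition sconj_complex :: "complex \<Rightarrow> complex" where
  "sconj_complex = cnj"

instance
proof
  fix x y :: complex
  show "sconj (x + y) = sconj x + sconj y" "sconj (x * y) = sconj x * sconj y"
    by (simp_all add: sconj_complex_def)
  show "x * sconj x = (norm x)\<^sup>2 *\<^sub>R 1"
    by (simp add: sconj_complex_def complex_mult_cnj cmod_power2 scaleR_conv_of_real)
  show "\<exists>r. x + sconj x = r *\<^sub>R 1"
    by (rule exI[of _ "2 * Re x"]) (simp add: sconj_complex_def complex_add_cnj scaleR_conv_of_real)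
qed

end

text \<open>
  A separable Hilbert space on the whole type \<open>'h\<close>. Norm, topology and completeness are those
  of the class \<^class>\<open>banach\<close>; the inner product is linear in its first argument and
  induces this norm.
\<close>

locale hilbert_space = vector_space scl
  for scl :: "'k::real_or_complex \<Rightarrow> 'h::banach \<Rightarrow> 'h" +
  fixes ip :: "'h \<Rightarrow> 'h \<Rightarrow> 'k"
  assumes scl_of_real: "scl (of_real r) x = r *\<^sub>R x"
    and ip_add_left: "ip (x + y) z = ip x z + ip y z"
    and ip_scl_left: "ip (scl a x) y = a * ip x y"
    and ip_commute: "ip x y = sconj (ip y x)"
    and ip_self: "ip x x = of_real ((norm x)\<^sup>2)"
    and separable: "\<exists>D::'h set. countable D \<and> closure D = UNIV"

lemma hilbert_space_real_inner:
  assumes "\<exists>D::'h::{real_inner,banach} set. countable D \<and> closure D = UNIV"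
  shows "hilbert_space (scaleR :: real \<Rightarrow> 'h \<Rightarrow> 'h) inner"
proof
  show "\<exists>D::'h set. countable D \<and> closure D = UNIV"
    by (fact assms)
  fix x y :: 'h
  show "inner x y = sconj (inner y x)"
    by (simp add: sconj_real_def inner_commute)
qed (auto simp: scaleR_add_right scaleR_add_left inner_add_left power2_norm_eq_inner)

lemma hilbert_space_complex: "hilbert_space (*) (\<lambda>x y :: complex. x * cnj y)"
proof
  obtain D :: "complex set" where "countable D" "closure D = UNIV"
    using separable[of "UNIV :: complex set"] by (metis top.extremum_uniqueI)
  then show "\<exists>D::complex set. countable D \<and> closure D = UNIV"
    by blast
  fix x y :: complex
  show "x * cnj y = sconj (y * cnj x)"
    by (simp add: sconj_complex_def)
  show "x * cnj x = of_real ((norm x)\<^sup>2)"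
    by (simp add: complex_mult_cnj cmod_power2)
qed (auto simp: algebra_simps scaleR_conv_of_real)

definition orthogonal_decomposition ::
  "('k::real_or_complex \<Rightarrow> 'h::banach \<Rightarrow> 'h) \<Rightarrow> ('h \<Rightarrow> 'h \<Rightarrow> 'k) \<Rightarrow> 'h set \<Rightarrow> 'h set \<Rightarrow> bool" where
  "orthogonal_decomposition scl ip M K \<longleftrightarrow>
     module.subspace scl M \<and> closed M \<and>
     module.subspace scl K \<and> closed K \<and>
     (\<forall>m\<in>M. \<forall>k\<in>K. ip m k = 0) \<and>
     (\<forall>x. \<exists>m\<in>M. \<exists>k\<in>K. x = m + k)"

definition orth_proj :: "('h::banach \<Rightarrow> 'h \<Rightarrow> 'k::real_or_complex) \<Rightarrow> 'h set \<Rightarrow> 'h \<Rightarrow> 'h" where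
  "orth_proj ip S x = (THE p. p \<in> S \<and> (\<forall>s\<in>S. ip (x - p) s = 0))"

definition parseval_frame ::
  "('h::banach \<Rightarrow> 'h \<Rightarrow> 'k::real_or_complex) \<Rightarrow> 'i set \<Rightarrow> ('i \<Rightarrow> 'h) \<Rightarrow> bool" where
  "parseval_frame ip I \<phi> \<longleftrightarrow>
     (\<forall>x. ((\<lambda>i. (norm (ip x (\<phi> i)))\<^sup>2) has_sum (norm x)\<^sup>2) I)"

definition analysis_op ::
  "('h::banach \<Rightarrow> 'h \<Rightarrow> 'k::real_or_complex) \<Rightarrow> ('i \<Rightarrow> 'h) \<Rightarrow> 'h \<Rightarrow> 'i \<Rightarrow> 'k" where
  "analysis_op ip \<phi> x = (\<lambda>i. ip x (\<phi> i))"

text \<open>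
  The \<open>\<ell>\<^sub>1\<close> norm is extended-valued: it is \<open>\<infinity>\<close> exactly on the sequences that
  are not absolutely summable.
\<close>

definition l1_norm :: "'i set \<Rightarrow> ('i \<Rightarrow> 'k::real_or_complex) \<Rightarrow> ennreal" where
  "l1_norm I c = (\<Sum>\<^sub>\<infinity>i\<in>I. ennreal (norm (c i)))"

definition clustered_sparse ::
  "('h::banach \<Rightarrow> 'h \<Rightarrow> 'k::real_or_complex) \<Rightarrow> 'i set \<Rightarrow> ('i \<Rightarrow> 'h) \<Rightarrow> 'i set \<Rightarrow> real \<Rightarrow> 'h \<Rightarrow> bool" where
  "clustered_sparse ip I \<phi> \<Lambda> \<delta> x \<longleftrightarrow>
     l1_norm I (\<lambda>i. indicator (I - \<Lambda>) i * analysis_op ip \<phi> x i) \<le> ennreal \<delta>"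

text \<open>
  Since the \<open>\<ell>\<^sub>1\<close> norm is a (finite) norm only on \<open>\<ell>\<^sub>1\<close>, the minimisation
  runs over those feasible points whose coefficients are absolutely summable. Otherwise every feasible
  point would count as a minimiser of an identically infinite objective.
\<close>

definition l1_analysis_minimizer ::
  "('h::banach \<Rightarrow> 'h \<Rightarrow> 'k::real_or_complex) \<Rightarrow> 'i set \<Rightarrow> ('i \<Rightarrow> 'h) \<Rightarrow> 'h set \<Rightarrow> 'h \<Rightarrow> 'h \<Rightarrow> bool" where
  "l1_analysis_minimizer ip I \<phi> K x0 xs \<longleftrightarrow>
     is_arg_min (\<lambda>x. l1_norm I (analysis_op ip \<phi> x))
       (\<lambda>x. l1_norm I (analysis_op ip \<phi> x) < \<infinity> \<and> orth_proj ip K x = orth_proj ip K x0) xs"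

text \<open>
  For infinite families the maximum over \<open>J\<close> need not be attained, so it is rendered as a
  supremum in \<open>[0, \<infinity>]\<close>.
\<close>

definition cluster_coherence ::
  "('h::banach \<Rightarrow> 'h \<Rightarrow> 'k::real_or_complex) \<Rightarrow> 'i set \<Rightarrow> ('i \<Rightarrow> 'h) \<Rightarrow> 'j set \<Rightarrow> ('j \<Rightarrow> 'h) \<Rightarrow> ennreal" where
  "cluster_coherence ip \<Lambda> \<phi>\<^sub>1 J \<phi>\<^sub>2 =
     (SUP j\<in>J. \<Sum>\<^sub>\<infinity>i\<in>\<Lambda>. ennreal (norm (ip (\<phi>\<^sub>1 i) (\<phi>\<^sub>2 j))))"

end

theory Submission
  imports Defs
begin

text \<open>
  The error \<open>h = xs - x0\<close> lies in \<open>H\<^sub>M\<close>, because both points have the same projection to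
  \<open>H\<^sub>K\<close>. Write \<open>b i = \<bar>\<langle>h, \<phi> i\<rangle>\<bar>\<close> and let \<open>P\<close> be the projection onto \<open>H\<^sub>M\<close>. Expanding
  \<open>\<langle>h, \<phi> i\<rangle> = \<langle>h, P (\<phi> i)\<rangle>\<close> in the Parseval frame gives
  \<open>b i \<le> (\<Sum>j. \<bar>\<langle>P (\<phi> i), \<phi> j\<rangle>\<bar> * b j)\<close>. Summed over \<open>i \<in> \<Lambda>\<close> and after exchanging the sums,
  this says that \<open>h\<close> is not concentrated on the cluster: its \<open>\<ell>\<^sub>1\<close> mass on \<open>\<Lambda>\<close> is at most
  \<open>\<mu>\<close> times its total mass \<open>N\<close>, where \<open>\<mu>\<close> is the cluster coherence (\<open>l1_cluster_le\<close>).

  On the other hand \<open>xs\<close> has no larger \<open>\<ell>\<^sub>1\<close> norm than \<open>x0\<close>, and \<open>x0\<close> has mass at most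
  \<open>\<delta>\<close> off \<open>\<Lambda>\<close>. So the mass of \<open>xs\<close> off \<open>\<Lambda>\<close> exceeds that of \<open>x0\<close> by at most the mass of
  \<open>h\<close> on \<open>\<Lambda>\<close>, and the mass of \<open>h\<close> off \<open>\<Lambda>\<close> is at most its mass on \<open>\<Lambda>\<close> plus \<open>2 * \<delta>\<close>.
  Together \<open>N \<le> 2 * \<mu> * N + 2 * \<delta>\<close>. Since the \<open>\<ell>\<^sub>2\<close> norm of the coefficients is \<open>norm h\<close> and is
  at most \<open>N\<close> (\<open>norm_le_l1_norm_analysis\<close>), the claim follows.

  One point needs care: nothing is assumed about the coefficients of \<open>x0\<close> on \<open>\<Lambda>\<close>. They might
  fail to be summable, in which case \<open>x0\<close> does not compete in the minimisation and \<open>N\<close>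
  is infinite. What is known beforehand is only that the coefficients of \<open>h\<close> are square summable on
  \<open>I\<close> and summable off \<open>\<Lambda>\<close>. The kernel \<open>\<bar>\<langle>P (\<phi> i), \<phi> j\<rangle>\<bar>\<close> is symmetric, so the
  coherence bounds its row sums as well as its column sums, and this suffices to deduce summability on
  \<open>\<Lambda>\<close> (\<open>infsum_cluster_le\<close>).
\<close>

section \<open>Sums of extended nonnegative reals\<close>

lemma infsum_ennreal_eq_SUP:
  fixes f :: "'a \<Rightarrow> ennreal"
  shows "infsum f A = (SUP F\<in>{F. finite F \<and> F \<subseteq> A}. sum f F)"
  by (rule nonneg_infsum_complete) simp

lemma infsum_cmult_ennreal:
  fixes f :: "'a \<Rightarrow> ennreal"
  shows "(\<Sum>\<^sub>\<infinity>i\<in>A. c * f i) = c * infsum f A"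
  unfolding infsum_ennreal_eq_SUP by (simp add: SUP_mult_left_ennreal sum_distrib_left)

lemma sum_le_infsum_ennreal:
  fixes f :: "'a \<Rightarrow> ennreal"
  assumes "finite F" "F \<subseteq> A"
  shows "sum f F \<le> infsum f A"
  unfolding infsum_ennreal_eq_SUP using assms by (intro SUP_upper) auto

lemma infsum_ennreal_leI:
  fixes f :: "'a \<Rightarrow> ennreal"
  assumes "\<And>F. finite F \<Longrightarrow> F \<subseteq> A \<Longrightarrow> sum f F \<le> c"
  shows "infsum f A \<le> c"
  unfolding infsum_ennreal_eq_SUP using assms by (intro SUP_least) auto

lemma infsum_mono_ennreal:
  fixes f :: "'a \<Rightarrow> ennreal"
  assumes "\<And>i. i \<in> A \<Longrightarrow> f i \<le> g i"
  shows "infsum f A \<le> infsum g A"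
  using assms by (intro infsum_mono nonneg_summable_on_complete) auto

lemma infsum_add_ennreal:
  fixes f :: "'a \<Rightarrow> ennreal"
  shows "(\<Sum>\<^sub>\<infinity>i\<in>A. f i + g i) = infsum f A + infsum g A"
  by (intro infsum_add nonneg_summable_on_complete) simp_all

lemma infsum_split_ennreal:
  fixes f :: "'a \<Rightarrow> ennreal"
  assumes "B \<subseteq> A"
  shows "infsum f A = infsum f B + infsum f (A - B)"
  using infsum_Un_disjoint[of f B "A - B"] assms by (simp add: Un_absorb1 nonneg_summable_on_complete)

lemma has_sum_imp_infsum_ennreal:
  assumes "(f has_sum s) A" "\<And>i. i \<in> A \<Longrightarrow> 0 \<le> f i"
  shows "(\<Sum>\<^sub>\<infinity>i\<in>A. ennreal (f i)) = ennreal s"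
proof -
  have "(\<Sum>i\<in>F. ennreal (f i)) = ennreal (sum f F)" if "F \<subseteq> A" for F
    using that assms(2) by (intro sum_ennreal) auto
  moreover have "ennreal (infsum f A) = (SUP F\<in>{F. finite F \<and> F \<subseteq> A}. ennreal (sum f F))"
    using assms by (intro infsum_nonneg_is_SUPREMUM_ennreal) (auto simp: summable_on_def)
  ultimately show ?thesis
    using infsumI[OF assms(1)] by (simp add: infsum_ennreal_eq_SUP)
qed

section \<open>Kernels with small row and column sums\<close>

text \<open>
  With \<open>F\<close> finite the exchange of the two sums is mere additivity, whatever the size of \<open>J\<close>.
\<close>

lemma sum_kernel_le_ennreal:
  fixes a :: "'i \<Rightarrow> 'j \<Rightarrow> ennreal"
  assumes "\<And>j. j \<in> J \<Longrightarrow> (\<Sum>\<^sub>\<infinity>i\<in>\<Lambda>. a i j) \<le> m"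
    and "finite F" "F \<subseteq> \<Lambda>"
  shows "(\<Sum>i\<in>F. \<Sum>\<^sub>\<infinity>j\<in>J. a i j * c j) \<le> m * infsum c J"
proof -
  have "(\<Sum>i\<in>F. \<Sum>\<^sub>\<infinity>j\<in>J. a i j * c j) = (\<Sum>\<^sub>\<infinity>j\<in>J. \<Sum>i\<in>F. a i j * c j)"
    using \<open>finite F\<close> by (induction F) (simp_all add: infsum_add_ennreal)
  also have "\<dots> \<le> (\<Sum>\<^sub>\<infinity>j\<in>J. m * c j)"
  proof (rule infsum_mono_ennreal)
    fix j assume "j \<in> J"
    have "(\<Sum>i\<in>F. a i j) \<le> m"
      using sum_le_infsum_ennreal[OF assms(2,3)] assms(1)[OF \<open>j \<in> J\<close>] by (rule order_trans)
    then show "(\<Sum>i\<in>F. a i j * c j) \<le> m * c j"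
      by (simp add: sum_distrib_right[symmetric] mult_right_mono)
  qed
  finally show ?thesis
    by (simp add: infsum_cmult_ennreal)
qed

text \<open>
  Where \<open>b\<close> exceeds the level \<open>t\<close>, the product \<open>t * (b - t)\<close> is at most \<open>b\<^sup>2\<close>.
\<close>

lemma infsum_excess_finite:
  fixes b :: "'i \<Rightarrow> ennreal"
  assumes "(\<Sum>\<^sub>\<infinity>i\<in>\<Lambda>. b i * b i) < \<infinity>" "0 < t"
  shows "(\<Sum>\<^sub>\<infinity>i\<in>\<Lambda>. b i - t) < \<infinity>"
proof -
  have "t * (\<Sum>\<^sub>\<infinity>i\<in>\<Lambda>. b i - t) = (\<Sum>\<^sub>\<infinity>i\<in>\<Lambda>. t * (b i - t))"
    by (simp add: infsum_cmult_ennreal)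
  also have "\<dots> \<le> (\<Sum>\<^sub>\<infinity>i\<in>\<Lambda>. b i * b i)"
  proof (rule infsum_mono_ennreal)
    fix i
    show "t * (b i - t) \<le> b i * b i"
    proof (cases "t \<le> b i")
      case True
      then show ?thesis by (intro mult_mono) (auto simp: diff_le_self_ennreal)
    next
      case False
      then have "b i < top"
        by (meson not_le less_le_trans top_greatest)
      with False have "b i - t = 0"
        by (intro diff_eq_0_ennreal) auto
      then show ?thesis by simp
    qed
  qed
  finally have "t * (\<Sum>\<^sub>\<infinity>i\<in>\<Lambda>. b i - t) < \<infinity>"
    using assms(1) by (rule le_less_trans)
  then show ?thesis
    using assms(2) by (auto simp: ennreal_mult_less_top)
qed

text \<open>
  Summing the hypothesis on \<open>b i\<close> over \<open>i \<in> \<Lambda>\<close> and bounding the columns gives the inequality,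
  which says little as long as both sides may be infinite. To get finiteness from square
  summability, apply the same argument to the excess \<open>b - t\<close> over a level \<open>t > 0\<close>, whose sum
  \<open>f t\<close> is finite. The part of \<open>b\<close> below the level contributes at most \<open>t\<close> to the right-hand
  side at each \<open>i\<close>, because the row sums are at most \<open>1\<close>; subtracting it leaves
  \<open>f t \<le> m * f t + m * T\<close>, with \<open>T\<close> the sum of \<open>b\<close> off \<open>\<Lambda>\<close>. Hence \<open>f t\<close> is
  bounded independently of \<open>t\<close>, and \<open>t\<close> can tend to \<open>0\<close>.
\<close>

lemma infsum_cluster_le:
  fixes a :: "'i \<Rightarrow> 'i \<Rightarrow> ennreal" and b :: "'i \<Rightarrow> ennreal" and m :: real
  assumes "\<Lambda> \<subseteq> I" and m: "0 \<le> m" "m < 1"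
    and col: "\<And>j. j \<in> I \<Longrightarrow> (\<Sum>\<^sub>\<infinity>i\<in>\<Lambda>. a i j) \<le> ennreal m"
    and row: "\<And>i. i \<in> \<Lambda> \<Longrightarrow> (\<Sum>\<^sub>\<infinity>j\<in>\<Lambda>. a i j) \<le> ennreal m"
    and dom: "\<And>i. i \<in> \<Lambda> \<Longrightarrow> b i \<le> (\<Sum>\<^sub>\<infinity>j\<in>I. a i j * b j)"
    and sq: "(\<Sum>\<^sub>\<infinity>i\<in>\<Lambda>. b i * b i) < \<infinity>"
    and off: "infsum b (I - \<Lambda>) < \<infinity>"
  shows "infsum b \<Lambda> < \<infinity>" "infsum b \<Lambda> \<le> ennreal m * infsum b I"
proof -
  define T where "T = enn2real (infsum b (I - \<Lambda>))"
  have T: "infsum b (I - \<Lambda>) = ennreal T" "0 \<le> T"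
    using off by (simp_all add: T_def)
  \<comment> \<open>\<open>S\<close> solves \<open>S = m * S + m * T\<close>, so it bounds every finite \<open>r\<close> with \<open>r \<le> m * r + m * T\<close>.\<close>
  define S where "S = m * T / (1 - m)"
  have S: "0 \<le> S"
    using m T by (simp add: S_def)
  have excess: "(\<Sum>\<^sub>\<infinity>i\<in>\<Lambda>. b i - ennreal t) \<le> ennreal S" if "0 < t" for t :: real
  proof -
    define f where "f = (\<Sum>\<^sub>\<infinity>i\<in>\<Lambda>. b i - ennreal t)"
    have f_fin: "f < \<infinity>"
      unfolding f_def using sq that by (intro infsum_excess_finite) auto
    have pointwise: "b i - ennreal t \<le>
        (\<Sum>\<^sub>\<infinity>j\<in>\<Lambda>. a i j * (b j - ennreal t)) + (\<Sum>\<^sub>\<infinity>j\<in>I - \<Lambda>. a i j * b j)"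
      if "i \<in> \<Lambda>" for i
    proof -
      let ?u = "\<Sum>\<^sub>\<infinity>j\<in>\<Lambda>. a i j * (b j - ennreal t)" and ?v = "\<Sum>\<^sub>\<infinity>j\<in>I - \<Lambda>. a i j * b j"
      have "b i \<le> (\<Sum>\<^sub>\<infinity>j\<in>\<Lambda>. a i j * b j) + ?v"
        using dom[OF that] infsum_split_ennreal[OF \<open>\<Lambda> \<subseteq> I\<close>] by simp
      also have "(\<Sum>\<^sub>\<infinity>j\<in>\<Lambda>. a i j * b j) \<le> (\<Sum>\<^sub>\<infinity>j\<in>\<Lambda>. ennreal t * a i j + a i j * (b j - ennreal t))"
      proof (rule infsum_mono_ennreal)
        fix j
        have "b j \<le> ennreal t + (b j - ennreal t)"
          by (auto simp: add_diff_self_ennreal)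
        then have "a i j * b j \<le> a i j * (ennreal t + (b j - ennreal t))"
          by (rule mult_left_mono) simp
        then show "a i j * b j \<le> ennreal t * a i j + a i j * (b j - ennreal t)"
          by (simp add: algebra_simps)
      qed
      also have "\<dots> = ennreal t * (\<Sum>\<^sub>\<infinity>j\<in>\<Lambda>. a i j) + ?u"
        by (simp add: infsum_add_ennreal infsum_cmult_ennreal)
      also have "ennreal t * (\<Sum>\<^sub>\<infinity>j\<in>\<Lambda>. a i j) \<le> ennreal t * 1"
        using row[OF that] m(2) by (intro mult_left_mono) (auto intro: order_trans simp: ennreal_le_1)
      finally show ?thesis
        by (simp add: ennreal_minus_le_iff add.assoc)
    qed
    have "f \<le> ennreal m * f + ennreal m * ennreal T"
      unfolding f_def
    proof (rule infsum_ennreal_leI)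
      fix F assume F: "finite F" "F \<subseteq> \<Lambda>"
      have "(\<Sum>i\<in>F. b i - ennreal t) \<le> (\<Sum>i\<in>F. \<Sum>\<^sub>\<infinity>j\<in>\<Lambda>. a i j * (b j - ennreal t))
          + (\<Sum>i\<in>F. \<Sum>\<^sub>\<infinity>j\<in>I - \<Lambda>. a i j * b j)"
        using pointwise F by (auto simp: sum.distrib[symmetric] intro!: sum_mono)
      also have "\<dots> \<le> ennreal m * (\<Sum>\<^sub>\<infinity>j\<in>\<Lambda>. b j - ennreal t) + ennreal m * infsum b (I - \<Lambda>)"
        using col F \<open>\<Lambda> \<subseteq> I\<close> by (intro add_mono sum_kernel_le_ennreal) auto
      finally show "(\<Sum>i\<in>F. b i - ennreal t) \<le>
          ennreal m * (\<Sum>\<^sub>\<infinity>j\<in>\<Lambda>. b j - ennreal t) + ennreal m * ennreal T"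
        by (simp add: T)
    qed
    moreover obtain r where r: "f = ennreal r" "0 \<le> r"
      using f_fin by (cases f) auto
    ultimately have "r \<le> m * r + m * T"
      using m T by (simp add: ennreal_mult[symmetric] ennreal_plus[symmetric] del: ennreal_plus)
    then have "r \<le> S"
      using m by (simp add: S_def field_simps)
    then show ?thesis
      using r by (simp add: f_def ennreal_leI)
  qed
  have le_S: "infsum b \<Lambda> \<le> ennreal S"
  proof (rule infsum_ennreal_leI)
    fix F assume F: "finite F" "F \<subseteq> \<Lambda>"
    show "sum b F \<le> ennreal S"
    proof (rule ennreal_le_epsilon)
      fix e :: real assume "0 < e"
      \<comment> \<open>The level is low enough for the at most \<open>card F\<close> truncated parts to add up to at most \<open>e\<close>.\<close>
      define t where "t = e / (real (card F) + 1)"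
      have t: "0 < t" "real (card F) * t \<le> e"
        using \<open>0 < e\<close> by (auto simp: t_def field_simps)
      have "sum b F \<le> (\<Sum>i\<in>F. ennreal t + (b i - ennreal t))"
        by (intro sum_mono) (auto simp: add_diff_self_ennreal)
      also have "\<dots> = ennreal (real (card F) * t) + (\<Sum>i\<in>F. b i - ennreal t)"
        using t by (simp add: sum.distrib ennreal_mult ennreal_of_nat_eq_real_of_nat)
      also have "\<dots> \<le> ennreal e + ennreal S"
        using t sum_le_infsum_ennreal[OF F] excess[OF t(1)]
        by (intro add_mono) (auto intro: order_trans ennreal_leI)
      finally show "sum b F \<le> ennreal S + ennreal e"
        by (simp add: add.commute)
    qed
  qed
  then show fin: "infsum b \<Lambda> < \<infinity>"
    by (rule le_less_trans) simp
  then obtain L where L: "infsum b \<Lambda> = ennreal L" "0 \<le> L"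
    by (cases "infsum b \<Lambda>") auto
  have "L \<le> S"
    using le_S L S by simp
  then have "L \<le> m * (L + T)"
    using m by (simp add: S_def field_simps)
  then show "infsum b \<Lambda> \<le> ennreal m * infsum b I"
    using infsum_split_ennreal[OF \<open>\<Lambda> \<subseteq> I\<close>, of b] L T m
    by (simp add: ennreal_mult[symmetric] ennreal_plus[symmetric] ennreal_leI del: ennreal_plus)
qed

section \<open>Scalars and inner products\<close>

lemma sconj_zero: "sconj (0 :: 'k::real_or_complex) = 0"
  using sconj_add[of "0 :: 'k" 0] by simp

lemma sconj_of_real: "sconj (of_real r :: 'k::real_or_complex) = of_real r"
proof (cases "r = 0")
  case False
  have "of_real r * sconj (of_real r :: 'k) = of_real r * of_real r"
    using mult_sconj[of "of_real r :: 'k"] by (simp add: power2_eq_square scaleR_conv_of_real)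
  with False show ?thesis by simp
qed (simp add: sconj_zero)

lemma norm_sconj: "norm (sconj z) = norm (z :: 'k::real_or_complex)"
proof (cases "z = 0")
  case False
  have "norm z * norm (sconj z) = norm z * norm z"
    using arg_cong[OF mult_sconj[of z], of norm] by (simp add: norm_mult power2_eq_square)
  with False show ?thesis by simp
qed (simp add: sconj_zero)

context hilbert_space
begin

lemma ip_add_right: "ip x (y + z) = ip x y + ip x z"
  by (metis ip_add_left ip_commute sconj_add)

lemma ip_diff_left: "ip (x - y) z = ip x z - ip y z"
  using ip_add_left[of "x - y" y z] by simp

lemma ip_diff_right: "ip x (y - z) = ip x y - ip x z"
  using ip_add_right[of x "y - z" z] by simp

lemma norm_ip_commute: "norm (ip x y) = norm (ip y x)"
  by (metis ip_commute norm_sconj)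

lemma ip_eq_zero_commute: "ip x y = 0 \<longleftrightarrow> ip y x = 0"
  by (metis norm_ip_commute norm_eq_zero)

lemma norm_add_square:
  "of_real ((norm (x + y))\<^sup>2) = of_real ((norm x)\<^sup>2) + of_real ((norm y)\<^sup>2) + (ip x y + ip y x)"
  by (simp only: ip_self[symmetric] ip_add_left ip_add_right) (simp add: algebra_simps)

section \<open>Parseval frames\<close>

text \<open>
  This is the part of the expansion \<open>\<langle>x, y\<rangle> = (\<Sum>j. \<langle>x, \<phi> j\<rangle> * \<langle>\<phi> j, y\<rangle>)\<close> that is needed.
  It follows by polarisation. Rescale \<open>x\<close> by the conjugate of \<open>\<langle>x, y\<rangle>\<close>, so that the inner
  product becomes \<open>c\<^sup>2\<close> with \<open>c = \<bar>\<langle>x, y\<rangle>\<bar>\<close>, and compare \<open>\<parallel>x' + y\<parallel>\<^sup>2\<close> with its frame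
  expansion: the triangle inequality in each coefficient bounds the cross terms by the products
  of absolute values.
\<close>

lemma parseval_norm_ip_le:
  assumes "parseval_frame ip I \<phi>"
  shows "ennreal (norm (ip x y)) \<le>
    (\<Sum>\<^sub>\<infinity>j\<in>I. ennreal (norm (ip y (\<phi> j))) * ennreal (norm (ip x (\<phi> j))))"
proof (cases "ip x y = 0")
  case False
  define c where "c = norm (ip x y)"
  define x' where "x' = scl (sconj (ip x y)) x"
  have c: "0 < c"
    using False by (simp add: c_def)
  have ip_x': "ip x' y = of_real (c\<^sup>2)"
    by (simp add: x'_def c_def ip_scl_left mult.commute mult_sconj scaleR_conv_of_real)
  then have "ip y x' = of_real (c\<^sup>2)"
    by (metis ip_commute sconj_of_real)
  with ip_x' have "(of_real ((norm (x' + y))\<^sup>2) :: 'k) = of_real ((norm x')\<^sup>2 + (norm y)\<^sup>2 + 2 * c\<^sup>2)"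
    by (simp only: norm_add_square) simp
  then have cross: "(norm (x' + y))\<^sup>2 = (norm x')\<^sup>2 + (norm y)\<^sup>2 + 2 * c\<^sup>2"
    by (simp only: of_real_eq_iff)
  have frame: "((\<lambda>j. (norm (ip z (\<phi> j)))\<^sup>2) has_sum (norm z)\<^sup>2) I" for z
    using assms by (simp add: parseval_frame_def)
  have "(\<lambda>j. norm (ip y (\<phi> j)) * norm (ip x (\<phi> j))) summable_on I"
    using abs_summable_product[of "\<lambda>j. norm (ip y (\<phi> j))" I "\<lambda>j. norm (ip x (\<phi> j))"]
      has_sum_imp_summable[OF frame] by (simp add: power2_eq_square norm_mult)
  then obtain s where s: "((\<lambda>j. norm (ip y (\<phi> j)) * norm (ip x (\<phi> j))) has_sum s) I"
    by (auto simp: summable_on_def)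
  have "(norm (x' + y))\<^sup>2 \<le> (norm x')\<^sup>2 + (norm y)\<^sup>2 + (2 * c) * s"
  proof (rule has_sum_mono)
    show "((\<lambda>j. (norm (ip (x' + y) (\<phi> j)))\<^sup>2) has_sum (norm (x' + y))\<^sup>2) I"
      by (rule frame)
    show "((\<lambda>j. (norm (ip x' (\<phi> j)))\<^sup>2 + (norm (ip y (\<phi> j)))\<^sup>2
          + (2 * c) * (norm (ip y (\<phi> j)) * norm (ip x (\<phi> j))))
        has_sum (norm x')\<^sup>2 + (norm y)\<^sup>2 + (2 * c) * s) I"
      by (intro has_sum_add frame has_sum_cmult_right s)
    fix j
    have "(norm (ip (x' + y) (\<phi> j)))\<^sup>2 \<le> (norm (ip x' (\<phi> j)) + norm (ip y (\<phi> j)))\<^sup>2"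
      by (intro power_mono) (simp_all add: ip_add_left norm_triangle_ineq)
    moreover have "norm (ip x' (\<phi> j)) = c * norm (ip x (\<phi> j))"
      by (simp add: x'_def c_def ip_scl_left norm_mult norm_sconj)
    ultimately show "(norm (ip (x' + y) (\<phi> j)))\<^sup>2 \<le> (norm (ip x' (\<phi> j)))\<^sup>2 + (norm (ip y (\<phi> j)))\<^sup>2
        + (2 * c) * (norm (ip y (\<phi> j)) * norm (ip x (\<phi> j)))"
      by (simp add: power2_sum algebra_simps)
  qed
  with cross have "2 * c\<^sup>2 \<le> (2 * c) * s"
    by simp
  with c have "c \<le> s"
    by (simp add: power2_eq_square)
  then show ?thesis
    using has_sum_imp_infsum_ennreal[OF s] by (simp add: c_def ennreal_mult ennreal_leI)
qed simp

text \<open>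
  Each coefficient is at most the \<open>\<ell>\<^sub>1\<close> norm \<open>N\<close>, so their squares sum to at most \<open>N\<^sup>2\<close>.
\<close>

lemma norm_le_l1_norm_analysis:
  assumes "parseval_frame ip I \<phi>"
  shows "ennreal (norm x) \<le> l1_norm I (analysis_op ip \<phi> x)"
proof -
  define N where "N = l1_norm I (analysis_op ip \<phi> x)"
  have bound: "ennreal (norm (ip x (\<phi> i))) \<le> N" if "i \<in> I" for i
    using sum_le_infsum_ennreal[of "{i}" I "\<lambda>i. ennreal (norm (ip x (\<phi> i)))"] that
    by (simp add: N_def l1_norm_def analysis_op_def)
  have "ennreal (norm x) * ennreal (norm x) = (\<Sum>\<^sub>\<infinity>i\<in>I. ennreal ((norm (ip x (\<phi> i)))\<^sup>2))"
    using has_sum_imp_infsum_ennreal[of "\<lambda>i. (norm (ip x (\<phi> i)))\<^sup>2" I "(norm x)\<^sup>2"] assms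
    by (simp add: parseval_frame_def ennreal_mult[symmetric] power2_eq_square)
  also have "\<dots> \<le> (\<Sum>\<^sub>\<infinity>i\<in>I. N * ennreal (norm (ip x (\<phi> i))))"
    using bound by (intro infsum_mono_ennreal) (simp add: power2_eq_square ennreal_mult mult_right_mono)
  also have "\<dots> = N * N"
    by (simp add: infsum_cmult_ennreal N_def l1_norm_def analysis_op_def)
  finally have "ennreal (norm x) * ennreal (norm x) \<le> N * N" .
  moreover have "N * N < ennreal (norm x) * ennreal (norm x)" if "N < ennreal (norm x)"
  proof -
    have "N * N \<le> ennreal (norm x) * N"
      using that by (intro mult_right_mono) auto
    also have "\<dots> < ennreal (norm x) * ennreal (norm x)"
      using that by (intro ennreal_mult_strict_left_mono) (auto intro: le_less_trans)
    finally show ?thesis .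
  qed
  ultimately show ?thesis
    unfolding N_def[symmetric] by (meson not_le)
qed

section \<open>Orthogonal decompositions\<close>

lemma orth_proj_unique:
  assumes "subspace S" "p \<in> S" "\<And>s. s \<in> S \<Longrightarrow> ip (x - p) s = 0"
  shows "orth_proj ip S x = p"
  unfolding orth_proj_def
proof (rule the_equality)
  fix q assume q: "q \<in> S \<and> (\<forall>s\<in>S. ip (x - q) s = 0)"
  have "q - p \<in> S"
    using q assms by (simp add: subspace_diff)
  then have "ip (x - p) (q - p) - ip (x - q) (q - p) = 0"
    using q assms by simp
  then have "ip (q - p) (q - p) = 0"
    by (simp add: ip_diff_left[symmetric])
  then show "q = p"
    by (simp add: ip_self)
qed (use assms in auto)

lemma orthogonal_decomposition_projections:
  assumes "orthogonal_decomposition scl ip M K"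
  shows "orth_proj ip M x \<in> M" "orth_proj ip K x \<in> K" "orth_proj ip M x + orth_proj ip K x = x"
proof -
  have sub: "subspace M" "subspace K" and orth: "\<And>m k. m \<in> M \<Longrightarrow> k \<in> K \<Longrightarrow> ip m k = 0"
    using assms by (auto simp: orthogonal_decomposition_def)
  obtain m k where mk: "m \<in> M" "k \<in> K" "x = m + k"
    using assms unfolding orthogonal_decomposition_def by blast
  have "orth_proj ip M x = m" "orth_proj ip K x = k"
    using sub mk orth by (auto intro!: orth_proj_unique simp: ip_eq_zero_commute[of k])
  with mk show "orth_proj ip M x \<in> M" "orth_proj ip K x \<in> K" "orth_proj ip M x + orth_proj ip K x = x"
    by auto
qed

section \<open>The mass of a vector on a cluster\<close>

text \<open>
  For \<open>h \<in> M\<close> the projection \<open>P\<close> onto \<open>M\<close> can be moved onto the frame vector: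
  \<open>\<langle>h, \<phi> i\<rangle> = \<langle>h, P (\<phi> i)\<rangle>\<close>. The kernel \<open>\<bar>\<langle>P (\<phi> i), \<phi> j\<rangle>\<bar>\<close> that results from the frame
  expansion equals \<open>\<bar>\<langle>P (\<phi> i), P (\<phi> j)\<rangle>\<bar>\<close>; by this symmetry the coherence controls
  both its rows and its columns.
\<close>

lemma l1_cluster_le:
  assumes "orthogonal_decomposition scl ip M K" "parseval_frame ip I \<phi>" "\<Lambda> \<subseteq> I" "h \<in> M"
    and \<mu>: "cluster_coherence ip \<Lambda> (\<lambda>i. orth_proj ip M (\<phi> i)) I \<phi> = ennreal \<mu>" "0 \<le> \<mu>" "\<mu> < 1"
    and off: "l1_norm (I - \<Lambda>) (analysis_op ip \<phi> h) < \<infinity>"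
  shows "l1_norm \<Lambda> (analysis_op ip \<phi> h) < \<infinity>"
    "l1_norm \<Lambda> (analysis_op ip \<phi> h) \<le> ennreal \<mu> * l1_norm I (analysis_op ip \<phi> h)"
proof -
  let ?P = "orth_proj ip M"
  define a where "a i j = ennreal (norm (ip (?P (\<phi> i)) (\<phi> j)))" for i j
  define b where "b i = ennreal (norm (ip h (\<phi> i)))" for i
  have P: "ip m (?P y) = ip m y" if "m \<in> M" for m y
  proof -
    have "ip m (orth_proj ip K y) = 0"
      using that assms(1) orthogonal_decomposition_projections(2)[OF assms(1)]
      by (auto simp: orthogonal_decomposition_def)
    then show ?thesis
      using orthogonal_decomposition_projections(3)[OF assms(1), of y] ip_add_right[of m "?P y" "orth_proj ip K y"]
      by simp
  qed
  have PM: "?P y \<in> M" for y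
    by (rule orthogonal_decomposition_projections(1)[OF assms(1)])
  have col: "(\<Sum>\<^sub>\<infinity>i\<in>\<Lambda>. a i j) \<le> ennreal \<mu>" if "j \<in> I" for j
    unfolding a_def \<mu>(1)[symmetric] cluster_coherence_def using that by (rule SUP_upper)
  have sym: "a i j = a j i" for i j
    using P[OF PM, of "\<phi> i" "\<phi> j"] P[OF PM, of "\<phi> j" "\<phi> i"] norm_ip_commute[of "?P (\<phi> i)" "?P (\<phi> j)"]
    by (simp add: a_def)
  have row: "(\<Sum>\<^sub>\<infinity>j\<in>\<Lambda>. a i j) \<le> ennreal \<mu>" if "i \<in> \<Lambda>" for i
    using col[of i] that \<open>\<Lambda> \<subseteq> I\<close> by (subst sym) auto
  have dom: "b i \<le> (\<Sum>\<^sub>\<infinity>j\<in>I. a i j * b j)" for i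
    using parseval_norm_ip_le[OF assms(2), of h "?P (\<phi> i)"] P[OF \<open>h \<in> M\<close>] by (simp add: a_def b_def)
  have "(\<Sum>\<^sub>\<infinity>i\<in>I. b i * b i) = ennreal ((norm h)\<^sup>2)"
    using has_sum_imp_infsum_ennreal[of "\<lambda>i. (norm (ip h (\<phi> i)))\<^sup>2" I "(norm h)\<^sup>2"] assms(2)
    by (simp add: parseval_frame_def b_def ennreal_mult[symmetric] power2_eq_square)
  then have "(\<Sum>\<^sub>\<infinity>i\<in>\<Lambda>. b i * b i) + (\<Sum>\<^sub>\<infinity>i\<in>I - \<Lambda>. b i * b i) = ennreal ((norm h)\<^sup>2)"
    by (simp only: infsum_split_ennreal[OF \<open>\<Lambda> \<subseteq> I\<close>, symmetric])
  then have "(\<Sum>\<^sub>\<infinity>i\<in>\<Lambda>. b i * b i) + (\<Sum>\<^sub>\<infinity>i\<in>I - \<Lambda>. b i * b i) < \<infinity>"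
    by simp
  then have "(\<Sum>\<^sub>\<infinity>i\<in>\<Lambda>. b i * b i) < \<infinity>"
    by simp
  moreover have l1: "l1_norm A (analysis_op ip \<phi> h) = infsum b A" for A
    by (simp add: l1_norm_def analysis_op_def b_def[abs_def])
  ultimately show "l1_norm \<Lambda> (analysis_op ip \<phi> h) < \<infinity>"
    "l1_norm \<Lambda> (analysis_op ip \<phi> h) \<le> ennreal \<mu> * l1_norm I (analysis_op ip \<phi> h)"
    using infsum_cluster_le[OF \<open>\<Lambda> \<subseteq> I\<close> \<mu>(2,3) col row dom] off by simp_all
qed

end

section \<open>Stability of the analysis minimiser\<close>

lemma l1_norm_triangle:
  assumes "\<And>i. i \<in> A \<Longrightarrow> norm (c i) \<le> norm (d i) + norm (e i)"
  shows "l1_norm A c \<le> l1_norm A d + l1_norm A e"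
proof -
  have "l1_norm A c \<le> (\<Sum>\<^sub>\<infinity>i\<in>A. ennreal (norm (d i)) + ennreal (norm (e i)))"
    unfolding l1_norm_def using assms
    by (intro infsum_mono_ennreal) (simp add: ennreal_plus[symmetric] ennreal_leI del: ennreal_plus)
  then show ?thesis
    by (simp add: l1_norm_def infsum_add_ennreal)
qed

lemma l1_norm_split: "\<Lambda> \<subseteq> I \<Longrightarrow> l1_norm I c = l1_norm \<Lambda> c + l1_norm (I - \<Lambda>) c"
  unfolding l1_norm_def by (rule infsum_split_ennreal)

lemma l1_norm_indicator:
  assumes "A \<subseteq> I"
  shows "l1_norm I (\<lambda>i. indicator A i * c i) = l1_norm A c"
proof -
  have "l1_norm A (\<lambda>i. indicator A i * c i) = l1_norm A c"
    unfolding l1_norm_def by (intro infsum_cong) simp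
  moreover have "l1_norm (I - A) (\<lambda>i. indicator A i * c i) = 0"
    unfolding l1_norm_def by (intro infsum_0) simp
  ultimately show ?thesis
    using l1_norm_split[OF assms, of "\<lambda>i. indicator A i * c i"] by simp
qed

theorem proposition2p7:
  fixes scl :: "'k::real_or_complex \<Rightarrow> 'h::banach \<Rightarrow> 'h"
    and ip :: "'h \<Rightarrow> 'h \<Rightarrow> 'k"
    and H\<^sub>M H\<^sub>K :: "'h set"
    and I \<Lambda> :: "'i set"
    and \<phi> :: "'i \<Rightarrow> 'h"
    and \<delta> :: real
    and x0 xs :: 'h
  assumes "hilbert_space scl ip"
    and "orthogonal_decomposition scl ip H\<^sub>M H\<^sub>K"
    and "parseval_frame ip I \<phi>"
    and "\<Lambda> \<subseteq> I"
    and "\<delta> > 0"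
    and "clustered_sparse ip I \<phi> \<Lambda> \<delta> x0"
    and "l1_analysis_minimizer ip I \<phi> H\<^sub>K x0 xs"
    and "cluster_coherence ip \<Lambda> (\<lambda>i. orth_proj ip H\<^sub>M (\<phi> i)) I \<phi> < 1 / 2"
  shows "norm (xs - x0) \<le>
    2 * \<delta> / (1 - 2 * enn2real (cluster_coherence ip \<Lambda> (\<lambda>i. orth_proj ip H\<^sub>M (\<phi> i)) I \<phi>))"
proof -
  interpret hilbert_space scl ip by fact
  define h where "h = xs - x0"
  define \<mu> where "\<mu> = enn2real (cluster_coherence ip \<Lambda> (\<lambda>i. orth_proj ip H\<^sub>M (\<phi> i)) I \<phi>)"
  have half: "(1 / 2 :: ennreal) = ennreal (1 / 2)"
    using divide_ennreal[of 1 2] by simp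
  have coh: "cluster_coherence ip \<Lambda> (\<lambda>i. orth_proj ip H\<^sub>M (\<phi> i)) I \<phi> = ennreal \<mu>"
    using assms(8) unfolding \<mu>_def half by (metis ennreal_enn2real ennreal_less_top order.strict_trans)
  have "0 \<le> \<mu>"
    by (simp add: \<mu>_def)
  then have \<mu>: "0 \<le> \<mu>" "\<mu> < 1 / 2"
    using assms(8) unfolding coh half ennreal_less_iff[OF \<open>0 \<le> \<mu>\<close>] by auto
  let ?n = "\<lambda>A x. l1_norm A (analysis_op ip \<phi> x)"
  have split: "?n I x = ?n \<Lambda> x + ?n (I - \<Lambda>) x" for x
    by (rule l1_norm_split[OF assms(4)])
  have tri: "?n A x \<le> ?n A y + ?n A z" if "x = y + z \<or> x = y - z" for A x y z
    using that by (intro l1_norm_triangle)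
      (auto simp: analysis_op_def ip_add_left ip_diff_left norm_triangle_ineq norm_triangle_ineq4)
  have x0_off: "?n (I - \<Lambda>) x0 \<le> ennreal \<delta>"
    using assms(6) by (simp add: clustered_sparse_def l1_norm_indicator)
  have xs_fin: "?n I xs < \<infinity>" and same: "orth_proj ip H\<^sub>K xs = orth_proj ip H\<^sub>K x0"
    and least: "\<And>y. ?n I y < \<infinity> \<Longrightarrow> orth_proj ip H\<^sub>K y = orth_proj ip H\<^sub>K x0 \<Longrightarrow> ?n I xs \<le> ?n I y"
    using assms(7) unfolding l1_analysis_minimizer_def is_arg_min_def by (auto simp: not_less)
  note proj = orthogonal_decomposition_projections[OF assms(2)]
  have "h = orth_proj ip H\<^sub>M xs - orth_proj ip H\<^sub>M x0"
    using proj(3)[of xs] proj(3)[of x0] same unfolding h_def by (metis add_diff_cancel_right)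
  then have "h \<in> H\<^sub>M"
    using proj(1) assms(2) by (simp add: orthogonal_decomposition_def subspace_diff)
  have h_off: "?n (I - \<Lambda>) h \<le> ?n (I - \<Lambda>) xs + ennreal \<delta>"
    using tri[of h xs x0 "I - \<Lambda>"] x0_off by (simp add: h_def) (meson add_left_mono order_trans)
  have xs_fin': "?n \<Lambda> xs < \<infinity>" "?n (I - \<Lambda>) xs < \<infinity>"
    using xs_fin split[of xs] by auto
  have h_off_fin: "?n (I - \<Lambda>) h < \<infinity>"
    using h_off xs_fin' by (auto intro: le_less_trans)
  have cluster: "?n \<Lambda> h < \<infinity>" "?n \<Lambda> h \<le> ennreal \<mu> * ?n I h"
    using l1_cluster_le[OF assms(2,3,4) \<open>h \<in> H\<^sub>M\<close> coh \<mu>(1) _ h_off_fin] \<mu> by auto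
  have x0_on: "?n \<Lambda> x0 \<le> ?n \<Lambda> xs + ?n \<Lambda> h"
    by (rule tri) (simp add: h_def)
  have "?n \<Lambda> x0 < \<infinity>" "?n (I - \<Lambda>) x0 < \<infinity>"
    using x0_on x0_off xs_fin' cluster(1) by (auto intro: le_less_trans)
  \<comment> \<open>Only now, with the coefficients of \<open>x0\<close> summable, is \<open>x0\<close> a competitor of \<open>xs\<close>.\<close>
  then have "?n I xs \<le> ?n I x0"
    by (intro least) (simp_all add: split)
  then have "?n \<Lambda> xs + ?n (I - \<Lambda>) xs \<le> (?n \<Lambda> xs + ?n \<Lambda> h) + ennreal \<delta>"
    unfolding split using add_mono[OF x0_on x0_off] by (rule order_trans)
  then have xs_off: "?n (I - \<Lambda>) xs \<le> ?n \<Lambda> h + ennreal \<delta>"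
    using xs_fin'(1) by (auto simp: add.assoc)
  obtain L where L: "?n \<Lambda> h = ennreal L" "0 \<le> L"
    using cluster(1) by (cases "?n \<Lambda> h") auto
  obtain T where T: "?n (I - \<Lambda>) h = ennreal T" "0 \<le> T"
    using h_off_fin by (cases "?n (I - \<Lambda>) h") auto
  have total: "?n I h = ennreal (L + T)"
    by (simp add: split L T)
  have "ennreal T \<le> (ennreal L + ennreal \<delta>) + ennreal \<delta>"
    using order_trans[OF h_off add_right_mono[OF xs_off]] by (simp add: T L)
  then have T_le: "T \<le> L + 2 * \<delta>"
    using L assms(5) by (simp add: ennreal_plus[symmetric] del: ennreal_plus)
  have L_le: "L \<le> \<mu> * (L + T)"
    using cluster(2) unfolding total using L T \<mu> by (simp add: ennreal_mult[symmetric] del: ennreal_plus)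
  have "norm h \<le> L + T"
    using norm_le_l1_norm_analysis[OF assms(3), of h] L T unfolding total by (simp del: ennreal_plus)
  also have "(L + T) * (1 - 2 * \<mu>) \<le> 2 * \<delta>"
    using T_le L_le by (simp add: algebra_simps)
  then have "L + T \<le> 2 * \<delta> / (1 - 2 * \<mu>)"
    using \<mu> by (simp add: pos_le_divide_eq)
  finally show ?thesis
    by (simp add: h_def \<mu>_def)
qed

end
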